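(* Let $\alpha,\lambda_0,\lambda_1,\lambda_3$ be real constants with $\alpha\neq 0$, $\lambda_0>0$, $\lambda_1>0$, $\lambda_3>0$. Consider the system $$\dot r_1=(\alpha r_1+2s_3)r_2-r_3s_2,\quad \dot r_2=r_3s_1-r_1(\alpha r_1+2s_3),\quad \dot r_3=r_1s_2-r_2s_1,$$ $$\dot s_1=(\alpha r_1+s_3)s_2-\alpha^2r_2r_3,\quad \dot s_2=(\alpha r_3-s_1)(\alpha r_1+s_3),\quad \dot s_3=-\alpha r_2s_3$$ in $\mathbb{R}^6$, and the scalar equation $$\dot s_2=-\frac{2\alpha\lambda_0(\lambda_0-\lambda_3s_2^2)}{\big(\lambda_1+\sqrt{4\alpha^2\lambda_0^2+\lambda_1^2}\big)\lambda_3},$$ which gives the vector field induced by this system on the invariant manifold $M$ described in the context. Then: (i) if $\alpha>0$, the stationary solution $s_2=-\sqrt{\lambda_0}/\sqrt{\lambda_3}$ of the scalar equation is asymptotically stable on the invariant manifold $M$, while the corresponding stationary solution of the six-dimensional system, $$r_1=0,\quad r_2=\frac{\lambda_1-\sqrt{4\alpha^2\lambda_0^2+\lambda_1^2}}{2\alpha^2\sqrt{\lambda_0\lambda_3}},\quad r_3=0,\quad s_1=0,\quad s_2=-\frac{\sqrt{\lambda_0}}{\sqrt{\lambda_3}},\quad s_3=0,$$ is unstable in the sense of Lyapunov in $\mathbb{R}^6$; (ii) if $\alpha<0$, the stationary solution $s_2=-\sqrt{\lambda_0}/\sqrt{\lambda_3}$ is unstable on the invariant manifold $M$, and the corresponding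 stationary solution of the six-dimensional system given in (i) is unstable in the sense of Lyapunov in $\mathbb{R}^6$.
   Context: The six-dimensional system is the form taken, after a linear change of variables, by Kirchhoff's equations of motion of a rigid body in an ideal fluid in Sokolov's case (with the parameter $\beta=0$). The invariant manifold $M\subset\mathbb{R}^6$ (for fixed $\alpha,\lambda_0,\lambda_1,\lambda_3$) is the curve given by $$s_1^2+s_2^2=\frac{\lambda_0}{\lambda_3},\quad s_3=0,\quad r_3=0,\quad r_1=c\,s_1,\quad r_2=c\,s_2,\qquad c=\frac{\sqrt{4\alpha^2\lambda_0^2+\lambda_1^2}-\lambda_1}{2\alpha^2\lambda_0}.$$ The scalar equation is obtained from the equation for $\dot s_2$ by eliminating all other variables by means of the equations of $M$. Stability, asymptotic stability and instability "on $M$" refer to the stationary solution of this scalar equation for $s_2$. Stability in $\mathbb{R}^6$ is the usual Lyapunov stability of an equilibrium of the full system. *)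

theory Defs
  imports "HOL-Analysis.Analysis"
begin

section \<open>Autonomous differential equations and Lyapunov stability\<close>

text \<open>At an endpoint of \<open>I\<close> belonging to \<open>I\<close> the derivative is one-sided.\<close>

definition solution_on ::
    "('a::real_normed_vector \<Rightarrow> 'a) \<Rightarrow> real set \<Rightarrow> (real \<Rightarrow> 'a) \<Rightarrow> bool" where
  "solution_on f I x \<longleftrightarrow>
     (\<forall>t\<in>I. (x has_vector_derivative f (x t)) (at t within I))"

text \<open>
  All solutions on intervals \<open>[0,T)\<close> are considered, whether or not they extend to
  \<open>[0,\<infinity>)\<close>; so instability means that there are actual solutions, starting
  arbitrarily close to \<open>p\<close>, that leave a fixed neighbourhood of \<open>p\<close> in finite time.
\<close>

definition lyapunov_stable :: "('a::real_normed_vector \<Rightarrow> 'a) \<Rightarrow> 'a \<Rightarrow> bool" where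
  "lyapunov_stable f p \<longleftrightarrow> f p = 0 \<and>
     (\<forall>\<epsilon>>0. \<exists>\<delta>>0. \<forall>T x. solution_on f {0..<T} x \<longrightarrow> dist (x 0) p < \<delta> \<longrightarrow>
        (\<forall>t\<in>{0..<T}. dist (x t) p < \<epsilon>))"

definition lyapunov_unstable :: "('a::real_normed_vector \<Rightarrow> 'a) \<Rightarrow> 'a \<Rightarrow> bool" where
  "lyapunov_unstable f p \<longleftrightarrow> f p = 0 \<and> \<not> lyapunov_stable f p"

text \<open>
  Attractivity includes global forward existence, so that it cannot hold for lack of
  solutions.
\<close>

definition asymptotically_stable :: "('a::real_normed_vector \<Rightarrow> 'a) \<Rightarrow> 'a \<Rightarrow> bool" where
  "asymptotically_stable f p \<longleftrightarrow> lyapunov_stable f p \<and>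
     (\<exists>\<delta>>0. \<forall>x0. dist x0 p < \<delta> \<longrightarrow>
        (\<exists>x. solution_on f {0..} x \<and> x 0 = x0) \<and>
        (\<forall>x. solution_on f {0..} x \<longrightarrow> x 0 = x0 \<longrightarrow> (x \<longlongrightarrow> p) at_top))"

definition invariant_set :: "('a::real_normed_vector \<Rightarrow> 'a) \<Rightarrow> 'a set \<Rightarrow> bool" where
  "invariant_set f S \<longleftrightarrow>
     (\<forall>I x. is_interval I \<longrightarrow> solution_on f I x \<longrightarrow>
        (\<exists>t\<in>I. x t \<in> S) \<longrightarrow> (\<forall>t\<in>I. x t \<in> S))"


section \<open>Kirchhoff's equations in Sokolov's case\<close>

text \<open>
  Points are \<open>(r\<^sub>1, r\<^sub>2, r\<^sub>3, s\<^sub>1, s\<^sub>2, s\<^sub>3)\<close>; the norm of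
  the iterated product type is the Euclidean one.
\<close>

type_synonym real6 = "real \<times> real \<times> real \<times> real \<times> real \<times> real"

definition kirchhoff_field :: "real \<Rightarrow> real6 \<Rightarrow> real6" where
  "kirchhoff_field \<alpha> = (\<lambda>(r1, r2, r3, s1, s2, s3).
     ((\<alpha> * r1 + 2 * s3) * r2 - r3 * s2,
      r3 * s1 - r1 * (\<alpha> * r1 + 2 * s3),
      r1 * s2 - r2 * s1,
      (\<alpha> * r1 + s3) * s2 - \<alpha>\<^sup>2 * r2 * r3,
      (\<alpha> * r3 - s1) * (\<alpha> * r1 + s3),
      - \<alpha> * r2 * s3))"

definition M_slope :: "real \<Rightarrow> real \<Rightarrow> real \<Rightarrow> real" where
  "M_slope \<alpha> lam0 lam1 = (sqrt (4 * \<alpha>\<^sup>2 * lam0\<^sup>2 + lam1\<^sup>2) - lam1) / (2 * \<alpha>\<^sup>2 * lam0)"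

definition M_curve :: "real \<Rightarrow> real \<Rightarrow> real \<Rightarrow> real \<Rightarrow> real6 set" where
  "M_curve \<alpha> lam0 lam1 lam3 = {(r1, r2, r3, s1, s2, s3).
     s1\<^sup>2 + s2\<^sup>2 = lam0 / lam3 \<and> s3 = 0 \<and> r3 = 0 \<and>
     r1 = M_slope \<alpha> lam0 lam1 * s1 \<and> r2 = M_slope \<alpha> lam0 lam1 * s2}"

definition scalar_field :: "real \<Rightarrow> real \<Rightarrow> real \<Rightarrow> real \<Rightarrow> real \<Rightarrow> real" where
  "scalar_field \<alpha> lam0 lam1 lam3 s2 =
     - (2 * \<alpha> * lam0 * (lam0 - lam3 * s2\<^sup>2)) /
       ((lam1 + sqrt (4 * \<alpha>\<^sup>2 * lam0\<^sup>2 + lam1\<^sup>2)) * lam3)"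

definition stationary_point :: "real \<Rightarrow> real \<Rightarrow> real \<Rightarrow> real \<Rightarrow> real6" where
  "stationary_point \<alpha> lam0 lam1 lam3 =
     (0, (lam1 - sqrt (4 * \<alpha>\<^sup>2 * lam0\<^sup>2 + lam1\<^sup>2)) / (2 * \<alpha>\<^sup>2 * sqrt (lam0 * lam3)), 0,
      0, - sqrt lam0 / sqrt lam3, 0)"

end

theory Submission imports Defs begin

text \<open>
  Put \<open>a = sqrt (lam0 / lam3)\<close> and \<open>c = M_slope \<alpha> lam0 lam1\<close>. The squared distance of a
  solution from the equations defining \<open>M\<close> satisfies a linear differential inequality, so by
  Gronwall \<open>M\<close> is invariant; on \<open>M\<close> the equation for \<open>s\<^sub>2\<close> is
  \<open>s\<^sub>2' = - \<alpha> * c * (a\<^sup>2 - s\<^sub>2\<^sup>2)\<close>, which is solved explicitly.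
  Instability is witnessed by explicit nonconstant orbits, defined for all times, that tend to the
  equilibrium as time tends to \<open>- \<infinity>\<close>. For \<open>\<alpha> < 0\<close> such an orbit lies on \<open>M\<close>. For
  \<open>\<alpha> > 0\<close> the equilibrium attracts on \<open>M\<close>, but its unstable manifold is a heteroclinic orbit
  with \<open>s\<^sub>3 \<noteq> 0\<close>, rational in hyperbolic functions of time, connecting it to its antipode.
\<close>

section \<open>Gronwall's inequality in both time directions\<close>

text \<open>The bound on \<open>\<bar>q' t\<bar>\<close> is two-sided: \<open>q' \<le> B * q\<close>
  keeps \<open>q\<close> at zero after \<open>t0\<close>, and \<open>q' \<ge> - B * q\<close> keeps
  it at zero before \<open>t0\<close>.\<close>

lemma gronwall_zero:
  fixes q q' K :: "real \<Rightarrow> real"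
  assumes I: "is_interval I" and t0: "t0 \<in> I" and t: "t \<in> I"
    and deriv: "\<And>t. t \<in> I \<Longrightarrow> (q has_vector_derivative q' t) (at t within I)"
    and bound: "\<And>t. t \<in> I \<Longrightarrow> \<bar>q' t\<bar> \<le> K t * q t"
    and nonneg: "\<And>t. t \<in> I \<Longrightarrow> 0 \<le> q t"
    and K: "continuous_on I K" and zero: "q t0 = 0"
  shows "q t = 0"
proof -
  let ?S = "closed_segment t0 t"
  have S: "?S \<subseteq> I"
    using I t0 t by (simp add: closed_segment_subset is_interval_convex)
  \<comment> \<open>\<open>K\<close> may be unbounded on \<open>I\<close>; compactness of the
    segment supplies a constant \<open>B\<close> that can enter an exponential integrating
    factor.\<close>
  have "compact (K ` ?S)"
    by (rule compact_continuous_image[OF continuous_on_subset[OF K S]]) simp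
  then obtain B where B: "\<And>s. s \<in> ?S \<Longrightarrow> \<bar>K s\<bar> \<le> B"
    by (force dest!: compact_imp_bounded simp: bounded_iff)
  have bd: "\<bar>q' s\<bar> \<le> B * q s" if "s \<in> ?S" for s
  proof -
    have "\<bar>q' s\<bar> \<le> K s * q s" using bound S that by blast
    also have "\<dots> \<le> B * q s"
      using B[OF that] nonneg S that by (intro mult_right_mono) auto
    finally show ?thesis .
  qed
  have dS: "(q has_real_derivative q' s) (at s within ?S)" if "s \<in> ?S" for s
    using deriv[of s] S that
    by (meson has_real_derivative_iff_has_vector_derivative has_vector_derivative_within_subset subsetD)
  have "q t \<le> 0"
  proof (cases "t0 \<le> t")
    case True
    have "q t * exp (- B * t) \<le> q t0 * exp (- B * t0)"
    proof (rule DERIV_nonpos_imp_decreasing_open[OF True])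
      fix s assume s: "t0 < s" "s < t"
      then have sS: "s \<in> ?S" using True by (auto simp: closed_segment_eq_real_ivl)
      \<comment> \<open>Strictly between the endpoints the derivative within the segment is a full
        derivative; at the endpoints, where it is one-sided, only continuity is required.\<close>
      have "at s within ?S = at s"
        using s True by (intro at_within_interior) (simp add: closed_segment_eq_real_ivl)
      then have "(q has_real_derivative q' s) (at s)" using dS[OF sS] by simp
      then have "((\<lambda>s. q s * exp (- B * s)) has_real_derivative (q' s - B * q s) * exp (- B * s)) (at s)"
        by (auto intro!: derivative_eq_intros simp: algebra_simps)
      then show "\<exists>y. ((\<lambda>s. q s * exp (- B * s)) has_real_derivative y) (at s) \<and> y \<le> 0"
        using bd[OF sS] by (auto intro!: exI mult_nonpos_nonneg)
    next
      have "continuous_on ?S q" using dS by (rule DERIV_continuous_on)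
      then show "continuous_on {t0..t} (\<lambda>s. q s * exp (- B * s))"
        using True by (auto intro!: continuous_intros simp: closed_segment_eq_real_ivl)
    qed
    then show ?thesis using zero by (simp add: mult_le_0_iff)
  next
    case False
    then have le: "t \<le> t0" by simp
    \<comment> \<open>Backward in time the factor has the opposite sign, and the lower bound on
      \<open>q'\<close> makes the product increase towards its value 0 at \<open>t0\<close>.\<close>
    have "q t * exp (B * t) \<le> q t0 * exp (B * t0)"
    proof (rule DERIV_nonneg_imp_increasing_open[OF le])
      fix s assume s: "t < s" "s < t0"
      then have sS: "s \<in> ?S" using le by (auto simp: closed_segment_eq_real_ivl)
      have "at s within ?S = at s"
        using s le by (intro at_within_interior) (simp add: closed_segment_eq_real_ivl)
      then have "(q has_real_derivative q' s) (at s)" using dS[OF sS] by simp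
      then have "((\<lambda>s. q s * exp (B * s)) has_real_derivative (q' s + B * q s) * exp (B * s)) (at s)"
        by (auto intro!: derivative_eq_intros simp: algebra_simps)
      then show "\<exists>y. ((\<lambda>s. q s * exp (B * s)) has_real_derivative y) (at s) \<and> 0 \<le> y"
        using bd[OF sS] by (auto intro!: exI mult_nonneg_nonneg)
    next
      have "continuous_on ?S q" using dS by (rule DERIV_continuous_on)
      then show "continuous_on {t..t0} (\<lambda>s. q s * exp (B * s))"
        using False by (auto intro!: continuous_intros simp: closed_segment_eq_real_ivl)
    qed
    then show ?thesis using zero by (simp add: mult_le_0_iff)
  qed
  then show ?thesis using nonneg t by force
qed

section \<open>Instability from an orbit emanating from the equilibrium\<close>

text \<open>Restarting the orbit at very negative times gives initial points arbitrarily close to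
  \<open>p\<close>, yet each restarted solution later passes through the fixed point
  \<open>x 0\<close>, away from \<open>p\<close>.\<close>

lemma lyapunov_unstable_if_alpha_limit:
  assumes "f p = 0" and sol: "solution_on f UNIV x" and lim: "(x \<longlongrightarrow> p) at_bot"
    and "x 0 \<noteq> p"
  shows "lyapunov_unstable f p"
  unfolding lyapunov_unstable_def
proof
  show "\<not> lyapunov_stable f p"
  proof
    assume "lyapunov_stable f p"
    \<comment> \<open>This distance is the \<open>\<epsilon>\<close> at which stability
      fails.\<close>
    moreover have "dist (x 0) p > 0" using assms(4) by simp
    ultimately obtain \<delta> where "\<delta> > 0" and \<delta>: "\<And>T y t. solution_on f {0..<T} y \<Longrightarrow>
        dist (y 0) p < \<delta> \<Longrightarrow> t \<in> {0..<T} \<Longrightarrow> dist (y t) p < dist (x 0) p"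
      unfolding lyapunov_stable_def by metis
    have "\<forall>\<^sub>F t in at_bot. dist (x t) p < \<delta> \<and> t < 0"
      using tendstoD[OF lim \<open>\<delta> > 0\<close>] eventually_gt_at_bot[of 0] by (rule eventually_conj)
    then obtain t0 where t0: "dist (x t0) p < \<delta>" "t0 < 0"
      by (auto dest!: eventually_happens)
    have "((\<lambda>t. x (t + t0)) has_vector_derivative f (x (t + t0))) (at t within S)" for t S
    proof -
      have "(x has_vector_derivative f (x (t + t0))) (at (t + t0))"
        using sol by (simp add: solution_on_def)
      moreover have "((\<lambda>t. t + t0) has_vector_derivative 1) (at t)"
        by (auto intro!: derivative_eq_intros)
      ultimately show ?thesis
        using vector_diff_chain_at[of "\<lambda>t. t + t0" 1 t x] has_vector_derivative_at_within
        by (fastforce simp: o_def)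
    qed
    \<comment> \<open>The half-open interval must contain \<open>- t0\<close>, the time at which the
      shifted orbit reaches \<open>x 0\<close>; hence the extra 1.\<close>
    then have "solution_on f {0..<1 - t0} (\<lambda>t. x (t + t0))"
      by (simp add: solution_on_def)
    from \<delta>[OF this, of "- t0"] t0 show False by simp
  qed
qed fact

section \<open>Invariance of the curve M\<close>

lemma has_vector_derivative_fst:
  "(x has_vector_derivative v) F \<Longrightarrow> ((\<lambda>t. fst (x t)) has_vector_derivative fst v) F"
  by (rule bounded_linear.has_vector_derivative[OF bounded_linear_fst])

lemma has_vector_derivative_snd:
  "(x has_vector_derivative v) F \<Longrightarrow> ((\<lambda>t. snd (x t)) has_vector_derivative snd v) F"
  by (rule bounded_linear.has_vector_derivative[OF bounded_linear_snd])

lemma abs_mult_le_sum_squares: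
  fixes x y :: real
  assumes "x\<^sup>2 + y\<^sup>2 \<le> Q"
  shows "\<bar>b * (x * y)\<bar> \<le> \<bar>b\<bar> * Q"
proof -
  have "2 * \<bar>x * y\<bar> \<le> x\<^sup>2 + y\<^sup>2"
    using sum_squares_bound[of "\<bar>x\<bar>" "\<bar>y\<bar>"] by (simp add: abs_mult)
  then have "\<bar>x * y\<bar> \<le> Q" using assms by linarith
  then show ?thesis by (simp add: abs_mult[of b] mult_left_mono)
qed

text \<open>For every slope \<open>c\<close> and level \<open>d\<close>, the derivatives of the five
  defects \<open>u\<close>, \<open>v\<close>, \<open>r3\<close>, \<open>s3\<close>, \<open>w\<close>
  are linear combinations of these defects, with coefficients polynomial in the solution. This is
  what bounds the derivative of their sum of squares by a multiple of that sum.\<close>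

lemma invariant_set_kirchhoff:
  "invariant_set (kirchhoff_field \<alpha>) {(r1, r2, r3, s1, s2, s3).
     s1\<^sup>2 + s2\<^sup>2 = d \<and> s3 = 0 \<and> r3 = 0 \<and> r1 = c * s1 \<and> r2 = c * s2}"
    (is "invariant_set _ ?M")
  unfolding invariant_set_def
proof (intro allI impI ballI)
  fix I x t
  assume I: "is_interval I" and sol: "solution_on (kirchhoff_field \<alpha>) I x"
    and ex: "\<exists>t\<in>I. x t \<in> ?M" and t: "t \<in> I"
  from ex obtain t0 where t0: "t0 \<in> I" "x t0 \<in> ?M" by (elim bexE)
  define r1 where "r1 t = fst (x t)" for t
  define r2 where "r2 t = fst (snd (x t))" for t
  define r3 where "r3 t = fst (snd (snd (x t)))" for t
  define s1 where "s1 t = fst (snd (snd (snd (x t))))" for t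
  define s2 where "s2 t = fst (snd (snd (snd (snd (x t)))))" for t
  define s3 where "s3 t = snd (snd (snd (snd (snd (x t)))))" for t
  note comps = r1_def r2_def r3_def s1_def s2_def s3_def
  have x: "x t = (r1 t, r2 t, r3 t, s1 t, s2 t, s3 t)" for t
    by (simp add: comps)
  define u where "u t = r1 t - c * s1 t" for t
  define v where "v t = r2 t - c * s2 t" for t
  define w where "w t = (s1 t)\<^sup>2 + (s2 t)\<^sup>2 - d" for t
  have M_iff: "x t \<in> ?M \<longleftrightarrow> u t = 0 \<and> v t = 0 \<and> r3 t = 0 \<and> s3 t = 0 \<and> w t = 0" for t
    by (auto simp: x u_def v_def w_def)
  define q where "q t = (u t)\<^sup>2 + (v t)\<^sup>2 + (r3 t)\<^sup>2 + (s3 t)\<^sup>2 + (w t)\<^sup>2" for t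
  have q_zero_iff: "q t = 0 \<longleftrightarrow> x t \<in> ?M" for t
    unfolding M_iff q_def by (auto simp: add_nonneg_eq_0_iff)
  \<comment> \<open>These are the coefficients of the products of defects in the derivative of
    \<open>q\<close>. The last summands of \<open>b2\<close> and \<open>b4\<close> come from
    \<open>r3' = s2 * u - s1 * v\<close>.\<close>
  define b1 where "b1 t = 2 * (2 * r2 t - c * s2 t)" for t
  define b2 where "b2 t = 2 * (c * \<alpha>\<^sup>2 * r2 t - s2 t) + 2 * s2 t" for t
  define b3 where "b3 t = 2 * (c * s1 t - 2 * r1 t)" for t
  define b4 where "b4 t = 2 * (s1 t - c * \<alpha> * (\<alpha> * r1 t + s3 t)) - 2 * s1 t" for t
  define b5 where "b5 t = - 2 * \<alpha> * r2 t" for t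
  define b6 where "b6 t = 4 * (\<alpha> * s2 t * (\<alpha> * r1 t + s3 t) - \<alpha>\<^sup>2 * r2 t * s1 t)" for t
  note b_defs = b1_def b2_def b3_def b4_def b5_def b6_def
  define q' where "q' t = b1 t * (u t * s3 t) + b2 t * (u t * r3 t) + b3 t * (v t * s3 t)
    + b4 t * (v t * r3 t) + b5 t * (s3 t * s3 t) + b6 t * (w t * r3 t)" for t
  define K where "K t = \<bar>b1 t\<bar> + \<bar>b2 t\<bar> + \<bar>b3 t\<bar> + \<bar>b4 t\<bar> + \<bar>b5 t\<bar> + \<bar>b6 t\<bar>" for t
  have cont: "continuous_on I x"
    using sol unfolding solution_on_def by (auto intro: continuous_on_vector_derivative)
  have "q t = 0"
  proof (rule gronwall_zero[OF I t0(1) t])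
    fix t assume t: "t \<in> I"
    have dx: "(x has_vector_derivative kirchhoff_field \<alpha> (x t)) (at t within I)"
      using sol t by (simp add: solution_on_def)
    note D = has_vector_derivative_fst has_vector_derivative_snd
    have d1: "(r1 has_real_derivative (\<alpha> * r1 t + 2 * s3 t) * r2 t - r3 t * s2 t) (at t within I)"
      using D(1)[OF dx]
      unfolding comps[abs_def]
      by (simp add: kirchhoff_field_def has_real_derivative_iff_has_vector_derivative case_prod_unfold)
    have d2: "(r2 has_real_derivative r3 t * s1 t - r1 t * (\<alpha> * r1 t + 2 * s3 t)) (at t within I)"
      using D(1)[OF D(2)[OF dx]]
      unfolding comps[abs_def]
      by (simp add: kirchhoff_field_def has_real_derivative_iff_has_vector_derivative case_prod_unfold)
    have d3: "(r3 has_real_derivative r1 t * s2 t - r2 t * s1 t) (at t within I)"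
      using D(1)[OF D(2)[OF D(2)[OF dx]]]
      unfolding comps[abs_def]
      by (simp add: kirchhoff_field_def has_real_derivative_iff_has_vector_derivative case_prod_unfold)
    have d4: "(s1 has_real_derivative (\<alpha> * r1 t + s3 t) * s2 t - \<alpha>\<^sup>2 * r2 t * r3 t) (at t within I)"
      using D(1)[OF D(2)[OF D(2)[OF D(2)[OF dx]]]]
      unfolding comps[abs_def]
      by (simp add: kirchhoff_field_def has_real_derivative_iff_has_vector_derivative case_prod_unfold)
    have d5: "(s2 has_real_derivative (\<alpha> * r3 t - s1 t) * (\<alpha> * r1 t + s3 t)) (at t within I)"
      using D(1)[OF D(2)[OF D(2)[OF D(2)[OF D(2)[OF dx]]]]]
      unfolding comps[abs_def]
      by (simp add: kirchhoff_field_def has_real_derivative_iff_has_vector_derivative case_prod_unfold)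
    have d6: "(s3 has_real_derivative - \<alpha> * r2 t * s3 t) (at t within I)"
      using D(2)[OF D(2)[OF D(2)[OF D(2)[OF D(2)[OF dx]]]]]
      unfolding comps[abs_def]
      by (simp add: kirchhoff_field_def has_real_derivative_iff_has_vector_derivative case_prod_unfold)
    \<comment> \<open>Each summand is arranged to contain a defect. The terms
      \<open>\<alpha> * r1 t * v t\<close> in \<open>u'\<close> and
      \<open>- \<alpha> * r1 t * u t\<close> in \<open>v'\<close> cancel in
      \<open>2 * (u * u' + v * v')\<close>, so they leave no trace in \<open>q'\<close>.\<close>
    define u' where "u' = (2 * r2 t - c * s2 t) * s3 t + (c * \<alpha>\<^sup>2 * r2 t - s2 t) * r3 t + \<alpha> * r1 t * v t"
    define v' where "v' = (c * s1 t - 2 * r1 t) * s3 t + (s1 t - c * \<alpha> * (\<alpha> * r1 t + s3 t)) * r3 t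
      - \<alpha> * r1 t * u t"
    define w' where "w' = b6 t / 2 * r3 t"
    have du: "(u has_real_derivative u') (at t within I)"
      unfolding u_def by (rule DERIV_cong[OF DERIV_diff[OF d1 DERIV_cmult[OF d4]]])
        (simp add: u'_def v_def, algebra)
    have dv: "(v has_real_derivative v') (at t within I)"
      unfolding v_def by (rule DERIV_cong[OF DERIV_diff[OF d2 DERIV_cmult[OF d5]]])
        (simp add: v'_def u_def, algebra)
    have dw: "(w has_real_derivative w') (at t within I)"
      unfolding w_def
      by (rule DERIV_cong[OF DERIV_diff[OF DERIV_add[OF DERIV_power[OF d4] DERIV_power[OF d5]] DERIV_const]])
        (simp add: w'_def b6_def algebra_simps power2_eq_square)
    have "(q has_real_derivative q' t) (at t within I)"
      unfolding q_def
      by (rule DERIV_cong[OF DERIV_add[OF DERIV_add[OF DERIV_add[OF DERIV_add[OF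
              DERIV_power[OF du] DERIV_power[OF dv]] DERIV_power[OF d3]] DERIV_power[OF d6]]
              DERIV_power[OF dw]]])
        (simp add: q'_def u'_def v'_def w'_def b1_def b2_def b3_def b4_def b5_def u_def v_def
          algebra_simps power2_eq_square)
    then show "(q has_vector_derivative q' t) (at t within I)"
      by (simp add: has_real_derivative_iff_has_vector_derivative)
    have "\<bar>b1 t * (u t * s3 t)\<bar> \<le> \<bar>b1 t\<bar> * q t" "\<bar>b2 t * (u t * r3 t)\<bar> \<le> \<bar>b2 t\<bar> * q t"
      "\<bar>b3 t * (v t * s3 t)\<bar> \<le> \<bar>b3 t\<bar> * q t" "\<bar>b4 t * (v t * r3 t)\<bar> \<le> \<bar>b4 t\<bar> * q t"
      "\<bar>b6 t * (w t * r3 t)\<bar> \<le> \<bar>b6 t\<bar> * q t"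
      by (rule abs_mult_le_sum_squares, simp add: q_def)+
    moreover have "\<bar>b5 t * (s3 t * s3 t)\<bar> \<le> \<bar>b5 t\<bar> * q t"
      unfolding abs_mult[of "b5 t"]
      by (rule mult_left_mono) (simp_all add: q_def power2_eq_square)
    ultimately show "\<bar>q' t\<bar> \<le> K t * q t"
      unfolding q'_def K_def distrib_right
      by (intro order_trans[OF abs_triangle_ineq] add_mono)
    show "0 \<le> q t" by (simp add: q_def)
  next
    show "continuous_on I K"
      unfolding K_def b_defs comps using cont by (intro continuous_intros)
    show "q t0 = 0" using t0 q_zero_iff by simp
  qed
  then show "x t \<in> ?M" using q_zero_iff by simp
qed

section \<open>Explicit orbits\<close>

definition sech :: "real \<Rightarrow> real" where "sech t = inverse (cosh t)"

lemma tanh_square_sech: "(tanh t)\<^sup>2 = 1 - (sech t)\<^sup>2"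
proof -
  have "(cosh t)\<^sup>2 * (tanh t)\<^sup>2 = (cosh t)\<^sup>2 * (1 - (sech t)\<^sup>2)"
    by (simp add: tanh_def sech_def power_divide cosh_square_eq right_diff_distrib power_inverse)
  then show ?thesis by simp
qed

lemma has_real_derivative_tanh_scaled:
  "((\<lambda>t. tanh (m * t)) has_real_derivative m * (sech (m * t))\<^sup>2) (at t within S)"
  using tanh_square_sech[of "m * t"]
  by (auto intro!: derivative_eq_intros)

lemma has_real_derivative_sech_scaled:
  "((\<lambda>t. sech (m * t)) has_real_derivative - m * sech (m * t) * tanh (m * t)) (at t within S)"
  unfolding sech_def tanh_def
  by (auto intro!: derivative_eq_intros simp: field_simps power2_eq_square)

lemma tendsto_tanh_sech_at_bot:
  assumes "m > 0"
  shows "((\<lambda>t. tanh (m * t)) \<longlongrightarrow> -1) at_bot" "((\<lambda>t. sech (m * t)) \<longlongrightarrow> 0) at_bot"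
proof -
  have lim: "filterlim (\<lambda>t. m * t) at_bot at_bot"
    using assms by (simp add: filterlim_tendsto_pos_mult_at_bot[OF tendsto_const _ filterlim_ident])
  show "((\<lambda>t. tanh (m * t)) \<longlongrightarrow> -1) at_bot"
    using filterlim_compose[OF tanh_real_at_bot lim] by simp
  show "((\<lambda>t. sech (m * t)) \<longlongrightarrow> 0) at_bot"
    unfolding sech_def
    by (rule filterlim_compose[OF tendsto_inverse_0_at_top filterlim_compose[OF cosh_real_at_bot lim]])
       (rule filterlim_ident)
qed

lemma solution_on_kirchhoffI:
  assumes "\<And>t. t \<in> I \<Longrightarrow> (r1 has_real_derivative
      (\<alpha> * r1 t + 2 * s3 t) * r2 t - r3 t * s2 t) (at t within I)"
    and "\<And>t. t \<in> I \<Longrightarrow> (r2 has_real_derivative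
      r3 t * s1 t - r1 t * (\<alpha> * r1 t + 2 * s3 t)) (at t within I)"
    and "\<And>t. t \<in> I \<Longrightarrow> (r3 has_real_derivative r1 t * s2 t - r2 t * s1 t) (at t within I)"
    and "\<And>t. t \<in> I \<Longrightarrow> (s1 has_real_derivative
      (\<alpha> * r1 t + s3 t) * s2 t - \<alpha>\<^sup>2 * r2 t * r3 t) (at t within I)"
    and "\<And>t. t \<in> I \<Longrightarrow> (s2 has_real_derivative
      (\<alpha> * r3 t - s1 t) * (\<alpha> * r1 t + s3 t)) (at t within I)"
    and "\<And>t. t \<in> I \<Longrightarrow> (s3 has_real_derivative - \<alpha> * r2 t * s3 t) (at t within I)"
  shows "solution_on (kirchhoff_field \<alpha>) I (\<lambda>t. (r1 t, r2 t, r3 t, s1 t, s2 t, s3 t))"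
  using assms
  by (auto simp: solution_on_def kirchhoff_field_def has_real_derivative_iff_has_vector_derivative
      intro!: has_vector_derivative_Pair)

text \<open>On M the vector \<open>(r1, r2)\<close> is \<open>c\<close> times
  \<open>(s1, s2)\<close>, which moves on the circle of radius \<open>a\<close>; the scalar equation
  for \<open>s2\<close> integrates to a hyperbolic tangent. For nonzero \<open>m\<close> the orbit
  joins the poles \<open>s2 = a\<close> and \<open>s2 = - a\<close>, and the sign of
  \<open>m\<close> decides the direction.\<close>

lemma kirchhoff_orbit_on_M:
  fixes \<alpha> c a :: real
  defines "m \<equiv> \<alpha> * c * a"
  shows "solution_on (kirchhoff_field \<alpha>) UNIV
    (\<lambda>t. (c * a * sech (m * t), - (c * a) * tanh (m * t), 0, a * sech (m * t), - a * tanh (m * t), 0))"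
  by (rule solution_on_kirchhoffI;
      rule DERIV_cong[OF DERIV_cmult[OF has_real_derivative_tanh_scaled]]
        DERIV_cong[OF DERIV_cmult[OF has_real_derivative_sech_scaled]] DERIV_cong[OF DERIV_const];
      simp add: m_def power2_eq_square)

text \<open>
  The closed form was found by expanding the unstable manifold in powers of
  \<open>exp (k * a * t)\<close> and resumming the series.
\<close>

lemma kirchhoff_separatrix:
  fixes \<alpha> c a :: real
  defines "k \<equiv> \<alpha> * c"
  defines "h \<equiv> \<lambda>t. sech (k * a * t)" and "T \<equiv> \<lambda>t. tanh (k * a * t)"
  defines "g \<equiv> \<lambda>t. inverse (1 + k\<^sup>2 * (h t)\<^sup>2)"
  shows "solution_on (kirchhoff_field \<alpha>) UNIV (\<lambda>t.
    (- (a * c * h t * (2 * g t - 1)),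
     a * c * T t * (2 * g t - 1),
     2 * a * c * k * h t * g t,
     - (a * h t * (1 - 2 * k\<^sup>2 * g t)),
     a * T t,
     2 * a * k * h t * g t))"
proof (rule solution_on_kirchhoffI)
  fix t :: real
  have pos: "1 + k\<^sup>2 * (h t)\<^sup>2 > 0"
    by (simp add: add_pos_nonneg)
  \<comment> \<open>This relation and \<open>g1\<close>, together with
    \<open>k = \<alpha> * c\<close>, turn the six equations into polynomial identities in
    \<open>h t\<close>, \<open>T t\<close> and \<open>g t\<close>.\<close>
  have T2: "(T t)\<^sup>2 = 1 - (h t)\<^sup>2"
    using tanh_square_sech[of "k * a * t"] by (simp add: h_def T_def)
  have g1: "k\<^sup>2 * (h t)\<^sup>2 * g t = 1 - g t"
    using pos by (simp add: g_def field_simps)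
  have dT: "(T has_real_derivative k * a * (h t)\<^sup>2) (at t)"
    unfolding T_def h_def by (rule has_real_derivative_tanh_scaled)
  have dh: "(h has_real_derivative - (k * a) * h t * T t) (at t)"
    unfolding T_def h_def by (rule has_real_derivative_sech_scaled)
  have "(g has_real_derivative 2 * k\<^sup>2 * (k * a) * (h t)\<^sup>2 * T t * (g t)\<^sup>2) (at t)"
    unfolding g_def using pos
    by (auto intro!: derivative_eq_intros dh simp: power2_eq_square)
  \<comment> \<open>Eliminating \<open>h\<close> through \<open>g1\<close> brings the derivative of
    \<open>g\<close> to logistic form.\<close>
  then have dg: "(g has_real_derivative 2 * (k * a) * T t * g t * (1 - g t)) (at t)"
    by (rule DERIV_cong) (use g1 in algebra)
  show "((\<lambda>t. - (a * c * h t * (2 * g t - 1))) has_real_derivative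
      (\<alpha> * (- (a * c * h t * (2 * g t - 1))) + 2 * (2 * a * k * h t * g t)) * (a * c * T t * (2 * g t - 1)) - (2 * a * c * k * h t * g t) * (a * T t)) (at t)"
    by (rule DERIV_cong[OF DERIV_minus[OF DERIV_mult[OF DERIV_cmult[OF dh, of "a * c"] DERIV_diff[OF DERIV_cmult[OF dg, of 2] DERIV_const[of 1]]]]])
      (algebra | use T2 g1 k_def in algebra)
  show "((\<lambda>t. a * c * T t * (2 * g t - 1)) has_real_derivative
      (2 * a * c * k * h t * g t) * (- (a * h t * (1 - 2 * k\<^sup>2 * g t))) - (- (a * c * h t * (2 * g t - 1))) * (\<alpha> * (- (a * c * h t * (2 * g t - 1))) + 2 * (2 * a * k * h t * g t))) (at t)"
    by (rule DERIV_cong[OF DERIV_mult[OF DERIV_cmult[OF dT, of "a * c"] DERIV_diff[OF DERIV_cmult[OF dg, of 2] DERIV_const[of 1]]]])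
      (algebra | use T2 g1 k_def in algebra)
  show "((\<lambda>t. 2 * a * c * k * h t * g t) has_real_derivative
      (- (a * c * h t * (2 * g t - 1))) * (a * T t) - (a * c * T t * (2 * g t - 1)) * (- (a * h t * (1 - 2 * k\<^sup>2 * g t)))) (at t)"
    by (rule DERIV_cong[OF DERIV_mult[OF DERIV_cmult[OF dh, of "2 * a * c * k"] dg]])
      (algebra | use T2 g1 k_def in algebra)
  show "((\<lambda>t. - (a * h t * (1 - 2 * k\<^sup>2 * g t))) has_real_derivative
      (\<alpha> * (- (a * c * h t * (2 * g t - 1))) + (2 * a * k * h t * g t)) * (a * T t) - \<alpha>\<^sup>2 * (a * c * T t * (2 * g t - 1)) * (2 * a * c * k * h t * g t)) (at t)"
    by (rule DERIV_cong[OF DERIV_minus[OF DERIV_mult[OF DERIV_cmult[OF dh, of a] DERIV_diff[OF DERIV_const[of 1] DERIV_cmult[OF dg, of "2 * k\<^sup>2"]]]]])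
      (algebra | use T2 g1 k_def in algebra)
  show "((\<lambda>t. a * T t) has_real_derivative
      (\<alpha> * (2 * a * c * k * h t * g t) - (- (a * h t * (1 - 2 * k\<^sup>2 * g t)))) * (\<alpha> * (- (a * c * h t * (2 * g t - 1))) + (2 * a * k * h t * g t))) (at t)"
    by (rule DERIV_cong[OF DERIV_cmult[OF dT, of a]])
      (algebra | use T2 g1 k_def in algebra)
  show "((\<lambda>t. 2 * a * k * h t * g t) has_real_derivative
      - \<alpha> * (a * c * T t * (2 * g t - 1)) * (2 * a * k * h t * g t)) (at t)"
    by (rule DERIV_cong[OF DERIV_mult[OF DERIV_cmult[OF dh, of "2 * a * k"] dg]])
      (algebra | use T2 g1 k_def in algebra)
qed

section \<open>The scalar equation\<close>

text \<open>The difference of the two right-hand sides factors as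
  \<open>k * (x + y) * (x - y)\<close>, so Gronwall applies to \<open>(x - y)\<^sup>2\<close>. The
  lemma serves to carry estimates for a closed-form solution over to every solution with the same
  initial value.\<close>

lemma scalar_solution_unique:
  fixes k d :: real
  assumes I: "is_interval I" "t0 \<in> I" "t \<in> I"
    and x: "solution_on (\<lambda>y. - k * (d - y\<^sup>2)) I x"
    and y: "solution_on (\<lambda>y. - k * (d - y\<^sup>2)) I y"
    and eq: "x t0 = y t0"
  shows "x t = y t"
proof -
  have "continuous_on I x" "continuous_on I y"
    using x y unfolding solution_on_def by (auto intro: continuous_on_vector_derivative)
  then have cont: "continuous_on I (\<lambda>t. 2 * \<bar>k * (x t + y t)\<bar>)"
    by (intro continuous_intros)
  have "(x t - y t)\<^sup>2 = 0"
  proof (rule gronwall_zero[OF I, where q = "\<lambda>t. (x t - y t)\<^sup>2", OF _ _ _ cont])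
    fix t assume "t \<in> I"
    then have "(x has_real_derivative - k * (d - (x t)\<^sup>2)) (at t within I)"
      "(y has_real_derivative - k * (d - (y t)\<^sup>2)) (at t within I)"
      using x y by (simp_all add: solution_on_def has_real_derivative_iff_has_vector_derivative)
    from DERIV_power[OF DERIV_diff[OF this], of 2]
    have "((\<lambda>t. (x t - y t)\<^sup>2) has_real_derivative 2 * (k * (x t + y t)) * (x t - y t)\<^sup>2)
        (at t within I)"
      by (rule DERIV_cong) (simp, algebra)
    then show "((\<lambda>t. (x t - y t)\<^sup>2) has_vector_derivative 2 * (k * (x t + y t)) * (x t - y t)\<^sup>2)
        (at t within I)"
      by (simp add: has_real_derivative_iff_has_vector_derivative)
    show "\<bar>2 * (k * (x t + y t)) * (x t - y t)\<^sup>2\<bar> \<le> 2 * \<bar>k * (x t + y t)\<bar> * (x t - y t)\<^sup>2"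
      by (simp add: abs_mult)
  qed (use eq in auto)
  then show ?thesis by simp
qed

text \<open>With \<open>y = w - a\<close> the equation becomes the logistic equation
  \<open>w' = - k * w * (2 * a - w)\<close>, whose explicit solution decays to 0 for small initial
  \<open>w\<close>.\<close>

lemma scalar_asymptotically_stable:
  fixes k a :: real
  assumes k: "k > 0" and a: "a > 0"
  shows "asymptotically_stable (\<lambda>y. - k * (a\<^sup>2 - y\<^sup>2)) (- a)"
proof -
  let ?f = "\<lambda>y. - k * (a\<^sup>2 - y\<^sup>2)"
  \<comment> \<open>The parameter \<open>w\<close> is the initial deviation from \<open>- a\<close>,
    and \<open>sol w\<close> is the logistic solution shifted back by \<open>a\<close>.\<close>
  define den where "den w t = w + (2 * a - w) * exp (2 * a * k * t)" for w t
  define sol where "sol w t = 2 * a * w / den w t - a" for w t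
  \<comment> \<open>This bound excludes blow-up forward in time and also shows that the deviation
    never exceeds its initial size.\<close>
  have den_ge: "den w t \<ge> 2 * a" if "\<bar>w\<bar> < a" "t \<ge> 0" for w t
  proof -
    have "(2 * a - w) * 1 \<le> (2 * a - w) * exp (2 * a * k * t)"
      using that k a by (intro mult_left_mono) auto
    then show ?thesis by (simp add: den_def)
  qed
  have sol_0: "sol w 0 = w - a" for w
    using a by (simp add: sol_def den_def)
  have sol: "solution_on ?f I (sol w)" if "\<bar>w\<bar> < a" "I \<subseteq> {0..}" for w I
    unfolding solution_on_def
  proof
    fix t assume "t \<in> I"
    then have nz: "den w t \<noteq> 0" using den_ge[of w t] that a by force
    have dden: "(den w has_real_derivative (2 * a - w) * (2 * a * k * exp (2 * a * k * t))) (at t within I)"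
      unfolding den_def by (auto intro!: derivative_eq_intros)
    have "((\<lambda>t. 2 * a * w / den w t - a) has_real_derivative
        - (2 * a * w * ((2 * a - w) * (2 * a * k * exp (2 * a * k * t)))) / (den w t * den w t)) (at t within I)"
      using nz by (auto intro!: derivative_eq_intros dden)
    moreover have "- (2 * a * w * ((2 * a - w) * (2 * a * k * exp (2 * a * k * t)))) / (den w t * den w t)
        = ?f (sol w t)"
    proof -
      have E: "(2 * a - w) * exp (2 * a * k * t) = den w t - w" by (simp add: den_def)
      have "(2 * a - w) * (2 * a * k * exp (2 * a * k * t)) = 2 * a * k * (den w t - w)"
        unfolding E[symmetric] by simp
      then show ?thesis
        unfolding sol_def using nz by (simp only:) (simp add: field_simps power2_eq_square)
    qed
    ultimately show "(sol w has_vector_derivative ?f (sol w t)) (at t within I)"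
      by (simp add: sol_def[abs_def] has_real_derivative_iff_has_vector_derivative)
  qed
  have unique: "x t = sol (x 0 + a) t"
    if "solution_on ?f I x" "dist (x 0) (- a) < a" "is_interval I" "0 \<in> I" "I \<subseteq> {0..}" "t \<in> I" for x I t
    using that sol_0 by (intro scalar_solution_unique[OF that(3,4,6,1) sol]) (auto simp: dist_real_def)
  have sol_dist: "dist (sol w t) (- a) \<le> \<bar>w\<bar>" if "\<bar>w\<bar> < a" "t \<ge> 0" for w t
  proof -
    have "2 * a * \<bar>w\<bar> \<le> den w t * \<bar>w\<bar>"
      using den_ge[OF that] by (intro mult_right_mono) auto
    then show ?thesis
      using den_ge[OF that] a
      by (simp add: sol_def dist_real_def abs_mult divide_le_eq mult.commute)
  qed
  have sol_lim: "(sol w \<longlongrightarrow> - a) at_top" if "\<bar>w\<bar> < a" for w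
  proof -
    have "filterlim (\<lambda>t. 2 * a * k * t) at_top at_top"
      using a k by (intro filterlim_tendsto_pos_mult_at_top[OF tendsto_const _ filterlim_ident]) simp
    then have "filterlim (\<lambda>t. exp (2 * a * k * t)) at_top at_top"
      by (rule filterlim_compose[OF exp_at_top])
    then have "filterlim (den w) at_top at_top"
      unfolding den_def using that a
      by (intro filterlim_tendsto_add_at_top[OF tendsto_const]
          filterlim_tendsto_pos_mult_at_top[OF tendsto_const]) auto
    then have "((\<lambda>t. 2 * a * w / den w t) \<longlongrightarrow> 0) at_top"
      by (intro tendsto_divide_0[OF tendsto_const] filterlim_at_top_imp_at_infinity)
    from tendsto_diff[OF this tendsto_const[of a]] show ?thesis
      by (simp add: sol_def[abs_def])
  qed
  show ?thesis
    unfolding asymptotically_stable_def lyapunov_stable_def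
  proof (intro conjI allI impI)
    fix \<epsilon> :: real assume "\<epsilon> > 0"
    show "\<exists>\<delta>>0. \<forall>T x. solution_on ?f {0..<T} x \<longrightarrow> dist (x 0) (- a) < \<delta> \<longrightarrow>
        (\<forall>t\<in>{0..<T}. dist (x t) (- a) < \<epsilon>)"
    \<comment> \<open>The bound \<open>a\<close> keeps the initial value where the closed form is
      controlled; since deviations do not grow, \<open>\<epsilon>\<close> itself suffices beyond
      that.\<close>
    proof (intro exI[of _ "min \<epsilon> a"] conjI allI impI ballI)
      fix T x t
      assume x: "solution_on ?f {0..<T} x" "dist (x 0) (- a) < min \<epsilon> a" and t: "t \<in> {0..<T}"
      have "x t = sol (x 0 + a) t"
        using x t by (intro unique[OF x(1)]) auto
      then show "dist (x t) (- a) < \<epsilon>"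
        using sol_dist[of "x 0 + a" t] x(2) t by (simp add: dist_real_def)
    qed (use \<open>\<epsilon> > 0\<close> a in simp)
  next
    show "\<exists>\<delta>>0. \<forall>x0. dist x0 (- a) < \<delta> \<longrightarrow> (\<exists>x. solution_on ?f {0..} x \<and> x 0 = x0) \<and>
        (\<forall>x. solution_on ?f {0..} x \<longrightarrow> x 0 = x0 \<longrightarrow> (x \<longlongrightarrow> - a) at_top)"
    proof (intro exI[of _ a] conjI allI impI a)
      fix x0 assume x0: "dist x0 (- a) < a"
      then have w: "\<bar>x0 + a\<bar> < a" by (simp add: dist_real_def)
      show "\<exists>x. solution_on ?f {0..} x \<and> x 0 = x0"
        using sol[OF w, of "{0..}"] sol_0[of "x0 + a"] by (intro exI[of _ "sol (x0 + a)"]) simp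
      fix x assume x: "solution_on ?f {0..} x" "x 0 = x0"
      have "x t = sol (x0 + a) t" if "t \<ge> 0" for t
        using unique[OF x(1), of t] x0 x(2) that by simp
      then have "\<forall>\<^sub>F t in at_top. sol (x0 + a) t = x t"
        by (intro eventually_at_top_linorderI[of 0]) simp
      then show "(x \<longlongrightarrow> - a) at_top"
        using sol_lim[OF w] by (rule Lim_transform_eventually[rotated])
    qed
  qed simp
qed

text \<open>The witness is the \<open>s2\<close> component of the orbit in
  \<open>kirchhoff_orbit_on_M\<close>, with \<open>k\<close> in the role of
  \<open>\<alpha> * c\<close>. Since \<open>- k * a\<close> is positive, it leaves
  \<open>- a\<close> at time minus infinity and passes through 0 at time 0.\<close>

lemma scalar_lyapunov_unstable:
  fixes k a :: real
  assumes k: "k < 0" and a: "a > 0"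
  shows "lyapunov_unstable (\<lambda>y. - k * (a\<^sup>2 - y\<^sup>2)) (- a)"
proof (rule lyapunov_unstable_if_alpha_limit)
  let ?x = "\<lambda>t. a * tanh (- k * a * t)"
  have "(?x has_real_derivative - k * (a\<^sup>2 - (?x t)\<^sup>2)) (at t)" for t
    using DERIV_cmult[OF has_real_derivative_tanh_scaled, of a "- k * a" t UNIV]
    by (rule DERIV_cong) (use tanh_square_sech[of "- k * a * t"] in algebra)
  then show "solution_on (\<lambda>y. - k * (a\<^sup>2 - y\<^sup>2)) UNIV ?x"
    by (simp add: solution_on_def has_real_derivative_iff_has_vector_derivative)
  show "(?x \<longlongrightarrow> - a) at_bot"
    using tendsto_mult[OF tendsto_const[of a] tendsto_tanh_sech_at_bot(1)[of "- k * a"]] k a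
    by (simp add: mult_neg_pos)
qed (use a in auto)

section \<open>Instability in the full space\<close>

text \<open>At the equilibrium \<open>r2 = - (c * a)\<close>, so the linearised equation for
  \<open>s3\<close> has growth rate \<open>\<alpha> * c * a\<close>. For positive
  \<open>\<alpha>\<close> this is an unstable direction transverse to M, followed by the separatrix;
  for negative \<open>\<alpha>\<close> the escape takes place inside M.\<close>

lemma kirchhoff_lyapunov_unstable:
  fixes \<alpha> c a :: real
  assumes \<alpha>: "\<alpha> \<noteq> 0" and c: "c > 0" and a: "a > 0"
  shows "lyapunov_unstable (kirchhoff_field \<alpha>) (0, - (c * a), 0, 0, - a, 0)"
proof (cases "\<alpha> > 0")
  case True
  define k where "k = \<alpha> * c"
  have k: "k > 0" "k * a > 0" using True c a by (simp_all add: k_def)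
  define h where "h t = sech (k * a * t)" for t
  define T where "T t = tanh (k * a * t)" for t
  define g where "g t = inverse (1 + k\<^sup>2 * (h t)\<^sup>2)" for t
  have T: "(T \<longlongrightarrow> - 1) at_bot" and h: "(h \<longlongrightarrow> 0) at_bot"
    using tendsto_tanh_sech_at_bot[OF k(2)] by (simp_all add: T_def[abs_def] h_def[abs_def])
  have "(g \<longlongrightarrow> inverse (1 + k\<^sup>2 * 0\<^sup>2)) at_bot"
    unfolding g_def[abs_def] 
    by (intro tendsto_inverse tendsto_add tendsto_mult tendsto_power tendsto_const h) simp
  then have g: "(g \<longlongrightarrow> 1) at_bot" by simp
  show ?thesis
  proof (rule lyapunov_unstable_if_alpha_limit)
    let ?x = "\<lambda>t. (- (a * c * h t * (2 * g t - 1)), a * c * T t * (2 * g t - 1),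
      2 * a * c * k * h t * g t, - (a * h t * (1 - 2 * k\<^sup>2 * g t)), a * T t, 2 * a * k * h t * g t)"
    show "solution_on (kirchhoff_field \<alpha>) UNIV ?x"
      using kirchhoff_separatrix[where \<alpha> = \<alpha> and c = c and a = a] unfolding g_def h_def T_def k_def .
    have "(?x \<longlongrightarrow> (- (a * c * 0 * (2 * 1 - 1)), a * c * (- 1) * (2 * 1 - 1),
        2 * a * c * k * 0 * 1, - (a * 0 * (1 - 2 * k\<^sup>2 * 1)), a * (- 1), 2 * a * k * 0 * 1)) at_bot"
      by (intro tendsto_Pair tendsto_minus tendsto_mult tendsto_diff tendsto_const h T g)
    then show "(?x \<longlongrightarrow> (0, - (c * a), 0, 0, - a, 0)) at_bot"
      by (simp add: mult.commute)
    \<comment> \<open>At time 0 the \<open>s2\<close> component is \<open>a * tanh 0 = 0\<close>,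
      which differs from \<open>- a\<close>.\<close>
    show "?x 0 \<noteq> (0, - (c * a), 0, 0, - a, 0)"
      using a by (simp add: T_def)
  qed (simp add: kirchhoff_field_def zero_prod_def)
next
  case False
  then have m: "- \<alpha> * c * a > 0"
    using \<alpha> c a by (simp add: mult_neg_pos)
  define h where "h t = sech (\<alpha> * c * a * t)" for t
  define T where "T t = tanh (\<alpha> * c * a * t)" for t
  \<comment> \<open>The limits of \<open>tanh\<close> and \<open>sech\<close> are stated for a
    positive rate, while \<open>\<alpha> * c * a\<close> is negative here; parity of the two
    functions reverses the sign.\<close>
  have neg: "h t = sech (- \<alpha> * c * a * t)" "T t = - tanh (- \<alpha> * c * a * t)" for t
    by (simp_all add: h_def T_def sech_def)
  have T: "(T \<longlongrightarrow> 1) at_bot" and h: "(h \<longlongrightarrow> 0) at_bot"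
    using tendsto_tanh_sech_at_bot[OF m] tendsto_minus[OF tendsto_tanh_sech_at_bot(1)[OF m]]
    by (simp_all only: neg[abs_def] minus_minus)
  show ?thesis
  proof (rule lyapunov_unstable_if_alpha_limit)
    let ?x = "\<lambda>t. (c * a * h t, - (c * a) * T t, 0, a * h t, - a * T t, 0)"
    show "solution_on (kirchhoff_field \<alpha>) UNIV ?x"
      using kirchhoff_orbit_on_M[where \<alpha> = \<alpha> and c = c and a = a] unfolding h_def T_def .
    have "(?x \<longlongrightarrow> (c * a * 0, - (c * a) * 1, 0, a * 0, - a * 1, 0)) at_bot"
      by (intro tendsto_Pair tendsto_mult tendsto_const h T)
    then show "(?x \<longlongrightarrow> (0, - (c * a), 0, 0, - a, 0)) at_bot"
      by simp
    show "?x 0 \<noteq> (0, - (c * a), 0, 0, - a, 0)"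
      using a by (simp add: T_def)
  qed (simp add: kirchhoff_field_def zero_prod_def)
qed

section \<open>From the parameters to slope \<open>c\<close> and radius \<open>a\<close>\<close>

theorem mainTheorem2:
  fixes \<alpha> lam0 lam1 lam3 :: real
  assumes "\<alpha> \<noteq> 0" and "lam0 > 0" and "lam1 > 0" and "lam3 > 0"
  shows
    "invariant_set (kirchhoff_field \<alpha>) (M_curve \<alpha> lam0 lam1 lam3) \<and>
     (\<forall>(r1, r2, r3, s1, s2, s3) \<in> M_curve \<alpha> lam0 lam1 lam3.
        \<exists>r1' r2' r3' s1' s3'. kirchhoff_field \<alpha> (r1, r2, r3, s1, s2, s3) =
          (r1', r2', r3', s1', scalar_field \<alpha> lam0 lam1 lam3 s2, s3')) \<and>
     stationary_point \<alpha> lam0 lam1 lam3 \<in> M_curve \<alpha> lam0 lam1 lam3 \<and>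
     (\<alpha> > 0 \<longrightarrow>
        asymptotically_stable (scalar_field \<alpha> lam0 lam1 lam3) (- sqrt lam0 / sqrt lam3) \<and>
        lyapunov_unstable (kirchhoff_field \<alpha>) (stationary_point \<alpha> lam0 lam1 lam3)) \<and>
     (\<alpha> < 0 \<longrightarrow>
        lyapunov_unstable (scalar_field \<alpha> lam0 lam1 lam3) (- sqrt lam0 / sqrt lam3) \<and>
        lyapunov_unstable (kirchhoff_field \<alpha>) (stationary_point \<alpha> lam0 lam1 lam3))"
proof -
  define a where "a = sqrt (lam0 / lam3)"
  define s where "s = sqrt (4 * \<alpha>\<^sup>2 * lam0\<^sup>2 + lam1\<^sup>2)"
  define c where "c = M_slope \<alpha> lam0 lam1"
  have a: "a > 0" "a\<^sup>2 = lam0 / lam3" and a_eq: "- sqrt lam0 / sqrt lam3 = - a"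
    using assms by (simp_all add: a_def) (simp_all add: real_sqrt_divide)
  have "s\<^sup>2 = 4 * \<alpha>\<^sup>2 * lam0\<^sup>2 + lam1\<^sup>2" "s \<ge> 0"
    by (simp_all add: s_def)
  \<comment> \<open>Rationalising the numerator by \<open>s\<^sup>2 - lam1\<^sup>2 = 4 *
    \<alpha>\<^sup>2 * lam0\<^sup>2\<close> makes the sign of \<open>c\<close> visible and produces
    the denominator of the scalar field.\<close>
  then have c_eq: "c = 2 * lam0 / (lam1 + s)" and s: "s \<ge> 0"
    using assms unfolding c_def M_slope_def s_def[symmetric]
    by (simp_all add: field_simps power2_eq_square)
  then have c: "c > 0" using assms by simp
  have scalar: "scalar_field \<alpha> lam0 lam1 lam3 = (\<lambda>y. - (\<alpha> * c) * (a\<^sup>2 - y\<^sup>2))"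
  proof
    fix y
    have "lam1 + s > 0" using assms s by simp
    then show "scalar_field \<alpha> lam0 lam1 lam3 y = - (\<alpha> * c) * (a\<^sup>2 - y\<^sup>2)"
      using assms unfolding scalar_field_def s_def[symmetric] c_eq a by (simp add: divide_simps)
  qed
  have p: "stationary_point \<alpha> lam0 lam1 lam3 = (0, - (c * a), 0, 0, - a, 0)"
  proof -
    have sqrt_eq: "sqrt (lam0 * lam3) = lam0 / a"
      using assms by (simp add: a_def real_sqrt_mult real_sqrt_divide field_simps)
    show ?thesis
      using assms a(1) unfolding stationary_point_def a_eq sqrt_eq c_def M_slope_def s_def[symmetric]
      by (simp add: field_simps)
  qed
  have M: "M_curve \<alpha> lam0 lam1 lam3 = {(r1, r2, r3, s1, s2, s3).
      s1\<^sup>2 + s2\<^sup>2 = a\<^sup>2 \<and> s3 = 0 \<and> r3 = 0 \<and> r1 = c * s1 \<and> r2 = c * s2}"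
    by (simp add: M_curve_def a c_def)
  have "\<forall>(r1, r2, r3, s1, s2, s3) \<in> M_curve \<alpha> lam0 lam1 lam3.
        \<exists>r1' r2' r3' s1' s3'. kirchhoff_field \<alpha> (r1, r2, r3, s1, s2, s3) =
          (r1', r2', r3', s1', scalar_field \<alpha> lam0 lam1 lam3 s2, s3')"
    \<comment> \<open>With \<open>r3 = s3 = 0\<close> and \<open>r1 = c * s1\<close>, the fifth
      component is \<open>- \<alpha> * c * s1\<^sup>2\<close>, and the circle equation replaces
      \<open>s1\<^sup>2\<close> by \<open>a\<^sup>2 - s2\<^sup>2\<close>.\<close>
    unfolding M scalar by (clarsimp simp: kirchhoff_field_def) algebra
  moreover have "stationary_point \<alpha> lam0 lam1 lam3 \<in> M_curve \<alpha> lam0 lam1 lam3"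
    by (simp add: p M)
  moreover have "invariant_set (kirchhoff_field \<alpha>) (M_curve \<alpha> lam0 lam1 lam3)"
    unfolding M by (rule invariant_set_kirchhoff)
  moreover have "lyapunov_unstable (kirchhoff_field \<alpha>) (stationary_point \<alpha> lam0 lam1 lam3)"
    unfolding p using assms(1) c a(1) by (rule kirchhoff_lyapunov_unstable)
  moreover have "asymptotically_stable (scalar_field \<alpha> lam0 lam1 lam3) (- sqrt lam0 / sqrt lam3)" if "\<alpha> > 0"
    unfolding scalar a_eq using that c a(1) by (intro scalar_asymptotically_stable) simp_all
  moreover have "lyapunov_unstable (scalar_field \<alpha> lam0 lam1 lam3) (- sqrt lam0 / sqrt lam3)" if "\<alpha> < 0"
    unfolding scalar a_eq using that c a(1) by (intro scalar_lyapunov_unstable) (simp_all add: mult_neg_pos)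
  ultimately show ?thesis by blast
qed

end
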